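(* Let $d,m\ge 1$, let $\mathbb{U}\subset\mathbb{R}^m$ be convex and compact, and let $v:[0,\infty)\times\mathbb{R}^d\to\mathbb{U}$ be a Borel measurable map (a deterministic Markov policy). Then there exists a family $\{\tilde v_{n,\eta}\}_{n\in\mathbb{N},\,\eta>0}$ of maps $\tilde v_{n,\eta}:[0,\infty)\times\mathbb{R}^d\to\mathbb{U}$ (deterministic Markov policies), each of which is Lipschitz continuous on $[0,\infty)\times\mathbb{R}^d$ and smooth ($C^\infty$), such that for all $f\in L^1([0,\infty)\times\mathbb{R}^d)\cap L^2([0,\infty)\times\mathbb{R}^d)$ and all bounded continuous $g:[0,\infty)\times\mathbb{R}^d\times\mathbb{U}\to\mathbb{R}$, $$\lim_{n\to\infty}\,\lim_{\eta\to 0}\int_0^\infty\!\!\int_{\mathbb{R}^d} f(t,x)\,g(t,x,\tilde v_{n,\eta}(t,x))\,dx\,dt=\int_0^\infty\!\!\int_{\mathbb{R}^d} f(t,x)\,g(t,x,v(t,x))\,dx\,dt .$$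
   Context: A deterministic Markov policy is a policy of the form $(t,x)\mapsto\delta_{f(t,x)}\in\mathscr{P}(\mathbb{U})$ with $f:[0,\infty)\times\mathbb{R}^d\to\mathbb{U}$ Borel measurable, where $\mathscr{P}(\mathbb{U})$ is the space of probability measures on $\mathbb{U}$; it is identified with the map $f$. Such a policy is called Lipschitz continuous (resp. smooth) if $f$ is Lipschitz continuous (resp. of class $C^\infty$, with one-sided time derivatives at $t=0$) in $(t,x)$. The convergence in the claim is convergence in the Borkar topology on Markov policies, written out for deterministic policies. *)

theory Defs
  imports "HOL-Analysis.Analysis"
begin

definition time_space :: "(real \<times> (real^'d)) set" where
  "time_space = {0..} \<times> UNIV"

text \<open>A deterministic Markov policy (the kernel sending z to the Dirac mass at \<open>w z\<close>) is
  identified with the Borel map \<open>w\<close>. Values of \<open>w\<close> outside \<open>time_space\<close> are irrelevant.\<close>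

definition det_Markov_policy :: "(real^'m) set \<Rightarrow> (real \<times> (real^'d) \<Rightarrow> real^'m) \<Rightarrow> bool" where
  "det_Markov_policy U w \<longleftrightarrow>
     w \<in> time_space \<rightarrow> U \<and> w \<in> borel_measurable (restrict_space borel time_space)"

text \<open>Derivatives are taken within \<open>S\<close>. At a boundary point \<open>(0, x)\<close> of \<open>time_space\<close> the time
  derivative is thus the one-sided one. The existential picks out a unique derivative whenever
  \<open>S\<close>, like \<open>time_space\<close>, is convex with nonempty interior; it should not be used for
  sets with, say, isolated points.\<close>

primrec Ck_on :: "nat \<Rightarrow> 'a::euclidean_space set \<Rightarrow> ('a \<Rightarrow> 'b::real_normed_vector) \<Rightarrow> bool" where
  "Ck_on 0 S f \<longleftrightarrow> continuous_on S f"
| "Ck_on (Suc k) S f \<longleftrightarrow>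
     (\<exists>f'. (\<forall>z\<in>S. (f has_derivative f' z) (at z within S)) \<and> (\<forall>h. Ck_on k S (\<lambda>z. f' z h)))"

definition smooth_on :: "'a::euclidean_space set \<Rightarrow> ('a \<Rightarrow> 'b::real_normed_vector) \<Rightarrow> bool" where
  "smooth_on S f \<longleftrightarrow> (\<forall>k. Ck_on k S f)"

definition policy_pairing ::
  "(real \<times> (real^'d) \<Rightarrow> real) \<Rightarrow> (real \<times> (real^'d) \<times> (real^'m) \<Rightarrow> real) \<Rightarrow>
   (real \<times> (real^'d) \<Rightarrow> real^'m) \<Rightarrow> real" where
  "policy_pairing f g w =
     (LINT t:{0..}|lebesgue. (LINT x|lebesgue. f (t, x) * g (t, x, w (t, x))))"

end

theory Submission
  imports Defs
begin

text \<open>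
  It suffices to find smooth Lipschitz policies \<open>w n\<close> that converge to \<open>v\<close> almost everywhere. The
  family \<open>\<lambda>n \<eta>. w n\<close>, constant in \<open>\<eta>\<close>, then does the job: its limit as \<open>\<eta>\<close> tends to 0 is the
  pairing of \<open>w n\<close> itself, and since \<open>g\<close> is bounded and continuous in the control and \<open>f\<close> is
  integrable, dominated convergence turns convergence almost everywhere into convergence of the
  pairings (\<open>policy_pairing_tendsto\<close>). Dominated convergence is applied on the product space; the
  iterated integral that defines the pairing is brought to that form by Fubini's theorem for the
  completed measure (\<open>lebesgue_integral_iterated\<close>).

  A measurable map is an almost everywhere limit of continuous maps, and composing these with the
  nearest-point projection onto \<open>U\<close>, which is continuous because \<open>U\<close> is closed and convex, makes
  them \<open>U\<close>-valued without spoiling the limit. So it remains to approximate a continuous \<open>U\<close>-valued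
  map \<open>h\<close> uniformly on a compact set \<open>K\<close>, here a large ball, by a smooth, globally Lipschitz,
  \<open>U\<close>-valued map (\<open>smooth_lipschitz_uniform_approximation\<close>). The set \<open>U\<close> may have empty interior,
  so the approximation must not leave \<open>U\<close> at all; this is ensured by using convex combinations of
  values of \<open>h\<close> at finitely many points \<open>c\<close> of \<open>K\<close>. The weights are proportional to the
  Gaussians \<open>exp (- r * (dist z c)\<^sup>2)\<close> with a large \<open>r\<close>, hence concentrate on the points \<open>c\<close> near
  \<open>z\<close>. Cancelling the common factor \<open>exp (- r * (z \<bullet> z))\<close> exhibits them as softmax weights of
  affine functions of \<open>z\<close>. The derivatives of such weights are polynomials in the weights, and the
  weights lie between 0 and 1: this gives smoothness and a global Lipschitz bound at once.
\<close>

section \<open>Calculus of functions with continuous derivatives up to order k\<close>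

lemma Ck_on_subset: "Ck_on k T f \<Longrightarrow> S \<subseteq> T \<Longrightarrow> Ck_on k S f"
proof (induction k arbitrary: f)
  case 0
  then show ?case by (auto intro: continuous_on_subset)
next
  case (Suc k)
  then obtain f' where "\<forall>z\<in>T. (f has_derivative f' z) (at z within T)"
    and "\<forall>h. Ck_on k T (\<lambda>z. f' z h)" by auto
  with Suc show ?case
    by (auto intro!: exI[of _ f'] intro: has_derivative_subset)
qed

lemma Ck_on_SucD: "Ck_on (Suc k) S f \<Longrightarrow> Ck_on k S f"
proof (induction k arbitrary: f)
  case 0
  then show ?case
    by (auto simp: continuous_on_eq_continuous_within dest: has_derivative_continuous)
next
  case (Suc k)
  then obtain f' where "\<forall>z\<in>S. (f has_derivative f' z) (at z within S)"
    and "\<forall>h. Ck_on (Suc k) S (\<lambda>z. f' z h)" by auto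
  with Suc.IH show ?case
    by (auto simp del: Ck_on.simps(2) simp: Ck_on.simps(2)[of k S f] intro!: exI[of _ f'])
qed

lemma Ck_on_const: "Ck_on k S (\<lambda>z. c)"
proof (induction k arbitrary: c)
  case (Suc k)
  then show ?case by (auto intro!: exI[of _ "\<lambda>z h. 0"])
qed simp

lemma Ck_on_add:
  "Ck_on k S f \<Longrightarrow> Ck_on k S g \<Longrightarrow> Ck_on k S (\<lambda>z. f z + g z)"
proof (induction k arbitrary: f g)
  case 0
  then show ?case by (auto intro: continuous_on_add)
next
  case (Suc k)
  then obtain f' g' where "\<forall>z\<in>S. (f has_derivative f' z) (at z within S)"
      "\<forall>h. Ck_on k S (\<lambda>z. f' z h)" "\<forall>z\<in>S. (g has_derivative g' z) (at z within S)"
      "\<forall>h. Ck_on k S (\<lambda>z. g' z h)"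
    by auto
  with Suc.IH show ?case
    by (auto intro!: exI[of _ "\<lambda>z h. f' z h + g' z h"] has_derivative_add)
qed

lemma Ck_on_sum:
  "(\<And>i. i \<in> I \<Longrightarrow> Ck_on k S (f i)) \<Longrightarrow> Ck_on k S (\<lambda>z. \<Sum>i\<in>I. f i z)"
  by (induction I rule: infinite_finite_induct) (auto intro: Ck_on_const Ck_on_add)

lemma Ck_on_scaleR:
  fixes f :: "'a::euclidean_space \<Rightarrow> real"
  shows "Ck_on k S f \<Longrightarrow> Ck_on k S g \<Longrightarrow> Ck_on k S (\<lambda>z. f z *\<^sub>R g z)"
proof (induction k arbitrary: f g)
  case 0
  then show ?case by (auto intro: continuous_on_scaleR)
next
  case (Suc k)
  then obtain f' g' where *: "\<forall>z\<in>S. (f has_derivative f' z) (at z within S)"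
      "\<forall>h. Ck_on k S (\<lambda>z. f' z h)" "\<forall>z\<in>S. (g has_derivative g' z) (at z within S)"
      "\<forall>h. Ck_on k S (\<lambda>z. g' z h)"
    by auto
  have "Ck_on k S f" "Ck_on k S g"
    using Suc.prems by (auto intro!: Ck_on_SucD simp del: Ck_on.simps)
  with * Suc.IH show ?case
    by (auto intro!: exI[of _ "\<lambda>z h. f z *\<^sub>R g' z h + f' z h *\<^sub>R g z"] has_derivative_scaleR Ck_on_add)
qed

section \<open>Averages with softmax weights\<close>

definition softmax :: "'i set \<Rightarrow> ('i \<Rightarrow> 'a::euclidean_space) \<Rightarrow> ('i \<Rightarrow> real) \<Rightarrow> 'i \<Rightarrow> 'a \<Rightarrow> real" where
  "softmax C a b i z = exp (a i \<bullet> z + b i) / (\<Sum>j\<in>C. exp (a j \<bullet> z + b j))"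

definition softmax_average ::
  "'i set \<Rightarrow> ('i \<Rightarrow> 'a::euclidean_space) \<Rightarrow> ('i \<Rightarrow> real) \<Rightarrow> ('i \<Rightarrow> 'b::real_normed_vector) \<Rightarrow> 'a \<Rightarrow> 'b"
where
  "softmax_average C a b u z = (\<Sum>i\<in>C. softmax C a b i z *\<^sub>R u i)"

context
  fixes C :: "'i set" and a :: "'i \<Rightarrow> 'a::euclidean_space" and b :: "'i \<Rightarrow> real"
  assumes C: "finite C" "C \<noteq> {}"
begin

lemma softmax_denominator_pos: "0 < (\<Sum>j\<in>C. exp (a j \<bullet> z + b j))"
  using C by (intro sum_pos) auto

lemma softmax_nonneg: "0 \<le> softmax C a b i z"
  using softmax_denominator_pos[of z] by (simp add: softmax_def)

lemma sum_softmax: "(\<Sum>i\<in>C. softmax C a b i z) = 1"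
  using softmax_denominator_pos[of z] by (simp add: softmax_def flip: sum_divide_distrib)

lemma softmax_le_1: "i \<in> C \<Longrightarrow> softmax C a b i z \<le> 1"
  using member_le_sum[of i C "\<lambda>i. softmax C a b i z"] C softmax_nonneg sum_softmax[of z] by auto

text \<open>A weight is tiny as soon as its exponent is far below that of a single competitor; the number
  of competitors does not matter.\<close>

lemma softmax_le_exp:
  assumes "j \<in> C"
  shows "softmax C a b i z \<le> exp ((a i \<bullet> z + b i) - (a j \<bullet> z + b j))"
proof -
  have "exp (a j \<bullet> z + b j) \<le> (\<Sum>j\<in>C. exp (a j \<bullet> z + b j))"
    using assms C by (intro member_le_sum) auto
  then show ?thesis
    unfolding softmax_def exp_diff by (intro divide_left_mono mult_pos_pos softmax_denominator_pos) auto
qed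

lemma softmax_has_derivative:
  "(softmax C a b i has_derivative
     (\<lambda>h. softmax C a b i z * (a i \<bullet> h - (\<Sum>j\<in>C. softmax C a b j z * (a j \<bullet> h))))) (at z within S)"
proof -
  let ?E = "\<lambda>j z. exp (a j \<bullet> z + b j)"
  let ?D = "\<lambda>z. \<Sum>j\<in>C. ?E j z"
  have E: "(?E j has_derivative (\<lambda>h. ?E j z * (a j \<bullet> h))) (at z within S)" for j
    by (auto intro!: derivative_eq_intros)
  have D: "(?D has_derivative (\<lambda>h. \<Sum>j\<in>C. ?E j z * (a j \<bullet> h))) (at z within S)"
    by (intro has_derivative_sum E)
  have "?D z \<noteq> 0"
    using softmax_denominator_pos[of z] by simp
  note has_derivative_divide'[OF E[of i] D this]
  moreover have "(?E i z * (a i \<bullet> h) * ?D z - ?E i z * (\<Sum>j\<in>C. ?E j z * (a j \<bullet> h))) / (?D z * ?D z)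
     = softmax C a b i z * (a i \<bullet> h - (\<Sum>j\<in>C. softmax C a b j z * (a j \<bullet> h)))" for h
  proof -
    have "(\<Sum>j\<in>C. softmax C a b j z * (a j \<bullet> h)) = (\<Sum>j\<in>C. ?E j z * (a j \<bullet> h)) / ?D z"
      by (simp add: softmax_def sum_divide_distrib)
    then show ?thesis
      using \<open>?D z \<noteq> 0\<close> unfolding softmax_def[of _ _ _ i] by (simp add: field_simps)
  qed
  ultimately show ?thesis
    by (simp add: softmax_def[abs_def])
qed

text \<open>The weights satisfy a first-order system whose right-hand side is polynomial in the weights.
  If they are of class \<open>k\<close>, then so are their derivatives, which makes them of class \<open>Suc k\<close>.\<close>

lemma Ck_on_softmax: "Ck_on k S (softmax C a b i)"
proof (induction k arbitrary: i)
  case 0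
  have "continuous_on S (softmax C a b i)"
    by (meson continuous_on_eq_continuous_within has_derivative_continuous softmax_has_derivative)
  then show ?case by simp
next
  case (Suc k)
  have "Ck_on k S (\<lambda>z. softmax C a b i z *\<^sub>R
      (a i \<bullet> h + (\<Sum>j\<in>C. softmax C a b j z *\<^sub>R (- (a j \<bullet> h)))))" for h
    by (intro Ck_on_scaleR Ck_on_add Ck_on_sum Ck_on_const Suc)
  then have "Ck_on k S (\<lambda>z. softmax C a b i z * (a i \<bullet> h - (\<Sum>j\<in>C. softmax C a b j z * (a j \<bullet> h))))" for h
    by (simp add: sum_negf)
  then show ?case
    using softmax_has_derivative[of i _ S] unfolding Ck_on.simps by (intro exI conjI ballI allI)
qed

lemma softmax_lipschitz:
  assumes "i \<in> C"
  shows "(norm (a i) + (\<Sum>j\<in>C. norm (a j)))-lipschitz_on UNIV (softmax C a b i)"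
proof (rule bounded_derivative_imp_lipschitz)
  fix z
  show "(softmax C a b i has_derivative
     (\<lambda>h. softmax C a b i z * (a i \<bullet> h - (\<Sum>j\<in>C. softmax C a b j z * (a j \<bullet> h))))) (at z within UNIV)"
    by (rule softmax_has_derivative)
  show "onorm (\<lambda>h. softmax C a b i z * (a i \<bullet> h - (\<Sum>j\<in>C. softmax C a b j z * (a j \<bullet> h))))
      \<le> norm (a i) + (\<Sum>j\<in>C. norm (a j))"
  proof (rule onorm_le)
    fix h
    have "\<bar>\<Sum>j\<in>C. softmax C a b j z * (a j \<bullet> h)\<bar> \<le> (\<Sum>j\<in>C. 1 * (norm (a j) * norm h))"
      unfolding real_norm_def[symmetric]
    proof (rule sum_norm_le)
      fix j assume "j \<in> C"
      then show "norm (softmax C a b j z * (a j \<bullet> h)) \<le> 1 * (norm (a j) * norm h)"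
        unfolding real_norm_def abs_mult
        by (intro mult_mono Cauchy_Schwarz_ineq2) (auto simp: softmax_nonneg softmax_le_1)
    qed
    moreover have "\<bar>a i \<bullet> h\<bar> \<le> norm (a i) * norm h"
      by (rule Cauchy_Schwarz_ineq2)
    ultimately have "\<bar>a i \<bullet> h - (\<Sum>j\<in>C. softmax C a b j z * (a j \<bullet> h))\<bar>
        \<le> (norm (a i) + (\<Sum>j\<in>C. norm (a j))) * norm h"
      by (simp add: distrib_right sum_distrib_right)
    then have "softmax C a b i z * \<bar>a i \<bullet> h - (\<Sum>j\<in>C. softmax C a b j z * (a j \<bullet> h))\<bar>
        \<le> 1 * ((norm (a i) + (\<Sum>j\<in>C. norm (a j))) * norm h)"
      using softmax_nonneg softmax_le_1[OF assms] by (intro mult_mono) auto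
    then show "norm (softmax C a b i z * (a i \<bullet> h - (\<Sum>j\<in>C. softmax C a b j z * (a j \<bullet> h))))
        \<le> (norm (a i) + (\<Sum>j\<in>C. norm (a j))) * norm h"
      by (simp add: abs_mult softmax_nonneg)
  qed
qed (auto intro!: add_nonneg_nonneg sum_nonneg)

lemma softmax_average_in_convex:
  assumes "convex U" and "\<And>i. i \<in> C \<Longrightarrow> u i \<in> U"
  shows "softmax_average C a b u z \<in> U"
  unfolding softmax_average_def
  using assms C softmax_nonneg sum_softmax by (intro convex_sum) auto

lemma smooth_on_softmax_average: "smooth_on S (softmax_average C a b u)"
  unfolding smooth_on_def softmax_average_def[abs_def]
  by (intro allI Ck_on_sum Ck_on_scaleR Ck_on_softmax Ck_on_const)

lemma softmax_average_lipschitz: "\<exists>L. L-lipschitz_on UNIV (softmax_average C a b u)"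
proof -
  let ?l = "\<lambda>i. norm (a i) + (\<Sum>j\<in>C. norm (a j))"
  have "(\<Sum>i\<in>C. ?l i * norm (u i))-lipschitz_on UNIV (softmax_average C a b u)"
  proof (rule lipschitz_onI)
    fix x y :: 'a
    have "dist (softmax_average C a b u x) (softmax_average C a b u y)
        = norm (\<Sum>i\<in>C. (softmax C a b i x - softmax C a b i y) *\<^sub>R u i)"
      by (simp add: dist_norm softmax_average_def sum_subtractf scaleR_diff_left)
    also have "\<dots> \<le> (\<Sum>i\<in>C. (?l i * dist x y) * norm (u i))"
    proof (rule sum_norm_le)
      fix i assume "i \<in> C"
      then show "norm ((softmax C a b i x - softmax C a b i y) *\<^sub>R u i) \<le> (?l i * dist x y) * norm (u i)"
        using lipschitz_onD[OF softmax_lipschitz, of i x y] unfolding norm_scaleR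
        by (intro mult_right_mono) (auto simp: dist_real_def)
    qed
    finally show "dist (softmax_average C a b u x) (softmax_average C a b u y)
        \<le> (\<Sum>i\<in>C. ?l i * norm (u i)) * dist x y"
      by (simp add: sum_distrib_left sum_distrib_right mult_ac)
  qed (auto intro!: add_nonneg_nonneg sum_nonneg mult_nonneg_nonneg)
  then show ?thesis by blast
qed

end

text \<open>The combination runs over a finite \<open>d\<close>-net \<open>C\<close> of \<open>K\<close>, where \<open>h\<close> varies by less than
  \<open>e / 2\<close> at distances below \<open>2 * d\<close>. Net points within \<open>2 * d\<close> of \<open>z\<close> therefore contribute at most
  \<open>e / 2\<close> to the error at \<open>z\<close>, whatever their weights. Every other net point competes with one
  within \<open>d\<close> of \<open>z\<close>, and the gap \<open>(2 * d)\<^sup>2 - d\<^sup>2 = 3 * d\<^sup>2\<close> between the squared distances bounds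
  its weight by \<open>exp (- s)\<close>, where \<open>s = r * (3 * d\<^sup>2)\<close>.\<close>

lemma smooth_lipschitz_uniform_approximation:
  fixes h :: "'a::euclidean_space \<Rightarrow> 'b::real_normed_vector"
  assumes "convex U" and K: "compact K" "K \<noteq> {}" and h: "continuous_on K h" "h ` K \<subseteq> U"
    and "e > 0"
  obtains w where "range w \<subseteq> U" and "\<exists>L. L-lipschitz_on UNIV w" and "smooth_on UNIV w"
    and "\<And>z. z \<in> K \<Longrightarrow> dist (w z) (h z) < e"
proof -
  obtain d where "d > 0" and d: "\<And>x y. x \<in> K \<Longrightarrow> y \<in> K \<Longrightarrow> dist x y < 2 * d \<Longrightarrow> dist (h x) (h y) < e / 2"
  proof -
    from compact_uniformly_continuous[OF h(1) K(1)] \<open>e > 0\<close>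
    obtain d0 where "d0 > 0" "\<And>x y. x \<in> K \<Longrightarrow> y \<in> K \<Longrightarrow> dist x y < d0 \<Longrightarrow> dist (h x) (h y) < e / 2"
      unfolding uniformly_continuous_on_def by (metis dist_commute half_gt_zero)
    then show thesis by (intro that[of "d0 / 2"]) auto
  qed
  obtain C where C: "C \<subseteq> K" "finite C" "K \<subseteq> (\<Union>c\<in>C. ball c d)"
    using compactE_image[OF K(1), of K "\<lambda>c. ball c d"] \<open>d > 0\<close> by force
  then have "C \<noteq> {}" using K by auto
  obtain M where M: "\<And>x. x \<in> K \<Longrightarrow> norm (h x) \<le> M" "M > 0"
    using compact_imp_bounded[OF compact_continuous_image[OF h(1) K(1)]]
    unfolding bounded_pos by auto
  \<comment> \<open>With this \<open>s\<close>, \<open>card C\<close> terms of size at most \<open>2 * M * exp (- s)\<close> add up to less than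
    \<open>e / 2\<close>.\<close>
  define s where "s = card C * (2 * M) * 2 / e"
  have "card C > 0" using C \<open>C \<noteq> {}\<close> by (simp add: card_gt_0_iff)
  then have "s > 0" using M \<open>e > 0\<close> by (simp add: s_def)
  define r where "r = s / (3 * d\<^sup>2)"
  have "r > 0" using \<open>s > 0\<close> \<open>d > 0\<close> by (simp add: r_def)
  let ?a = "\<lambda>c. (2 * r) *\<^sub>R c" and ?b = "\<lambda>c. - r * (c \<bullet> c)"
  let ?w = "softmax C ?a ?b"
  let ?h = "softmax_average C ?a ?b h"
  \<comment> \<open>The exponents are \<open>- r * (dist z c)\<^sup>2\<close> up to the common summand \<open>r * (z \<bullet> z)\<close>.\<close>
  have dist2: "(?a c \<bullet> z + ?b c) - (?a c' \<bullet> z + ?b c') = r * ((dist z c')\<^sup>2 - (dist z c)\<^sup>2)" for c c' z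
    by (simp add: dist_norm power2_norm_eq_inner inner_diff_left inner_diff_right inner_commute algebra_simps)
  have "dist (?h z) (h z) < e" if "z \<in> K" for z
  proof -
    have "z \<in> (\<Union>c\<in>C. ball c d)"
      using C(3) that by blast
    then obtain c0 where c0: "c0 \<in> C" "dist z c0 < d"
      by (auto simp: dist_commute)
    have far: "?w c z \<le> exp (- s)" if "dist z c \<ge> 2 * d" for c
    proof -
      have "(dist z c0)\<^sup>2 \<le> d\<^sup>2" "(2 * d)\<^sup>2 \<le> (dist z c)\<^sup>2"
        using c0 \<open>d > 0\<close> power_mono[OF that, of 2] by (auto intro!: power_mono)
      then have "r * ((dist z c0)\<^sup>2 - (dist z c)\<^sup>2) \<le> r * (- 3 * d\<^sup>2)"
        using \<open>r > 0\<close> by (intro mult_left_mono) (auto simp: power_mult_distrib)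
      also have "\<dots> = - s"
        using \<open>d > 0\<close> by (simp add: r_def field_simps)
      finally show ?thesis
        using softmax_le_exp[OF C(2) \<open>C \<noteq> {}\<close> c0(1), of ?a ?b c z] unfolding dist2
        by (meson exp_le_cancel_iff order_trans)
    qed
    have "?h z - h z = (\<Sum>c\<in>C. ?w c z *\<^sub>R (h c - h z))"
      using sum_softmax[OF C(2) \<open>C \<noteq> {}\<close>, of ?a ?b z]
      by (simp add: softmax_average_def scaleR_diff_right sum_subtractf flip: scaleR_sum_left)
    also have "norm \<dots> \<le> (\<Sum>c\<in>C. ?w c z * (e / 2) + exp (- s) * (2 * M))"
    proof (rule sum_norm_le)
      fix c assume "c \<in> C"
      then have "c \<in> K" using C by auto
      note nonneg = softmax_nonneg[OF C(2) \<open>C \<noteq> {}\<close>, of ?a ?b c z]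
      show "norm (?w c z *\<^sub>R (h c - h z)) \<le> ?w c z * (e / 2) + exp (- s) * (2 * M)"
      proof (cases "dist z c < 2 * d")
        case True
        then have "norm (h c - h z) \<le> e / 2"
          using d[OF \<open>c \<in> K\<close> \<open>z \<in> K\<close>] by (simp add: dist_commute dist_norm)
        then have "?w c z * norm (h c - h z) \<le> ?w c z * (e / 2)"
          using nonneg by (intro mult_left_mono)
        moreover have "0 \<le> exp (- s) * (2 * M)" using M by simp
        ultimately show ?thesis
          using nonneg unfolding norm_scaleR abs_of_nonneg[OF nonneg] by linarith
      next
        case False
        have "norm (h c - h z) \<le> 2 * M"
          using norm_triangle_ineq4[of "h c" "h z"] M(1)[OF \<open>c \<in> K\<close>] M(1)[OF \<open>z \<in> K\<close>] by simp
        then have "?w c z * norm (h c - h z) \<le> exp (- s) * (2 * M)"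
          using far[of c] False nonneg M by (intro mult_mono) auto
        moreover have "0 \<le> ?w c z * (e / 2)" using nonneg \<open>e > 0\<close> by simp
        ultimately show ?thesis
          using nonneg unfolding norm_scaleR abs_of_nonneg[OF nonneg] by linarith
      qed
    qed
    also have "\<dots> = e / 2 + card C * (2 * M) * exp (- s)"
      using sum_softmax[OF C(2) \<open>C \<noteq> {}\<close>, of ?a ?b z]
      by (simp add: sum.distrib flip: sum_divide_distrib sum_distrib_right)
    also have "card C * (2 * M) = s * e / 2"
      using \<open>e > 0\<close> by (simp add: s_def)
    also have "s * e / 2 * exp (- s) < e / 2"
    proof -
      have "s < exp s" using exp_ge_add_one_self[of s] by linarith
      then have "s * exp (- s) < 1" by (simp add: exp_minus field_simps)
      then show ?thesis using \<open>e > 0\<close> by (simp add: field_simps)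
    qed
    finally show ?thesis by (simp add: dist_norm)
  qed
  moreover have "range ?h \<subseteq> U"
    using C(1) h(2) by (auto intro!: softmax_average_in_convex[OF C(2) \<open>C \<noteq> {}\<close> \<open>convex U\<close>])
  ultimately show thesis
    by (intro that[of ?h] softmax_average_lipschitz smooth_on_softmax_average C(2) \<open>C \<noteq> {}\<close>)
qed

section \<open>Almost everywhere approximation of measurable maps\<close>

text \<open>Only the balls \<open>cball 0 n\<close> are controlled at stage \<open>n\<close>; every point lies in all but finitely
  many of them, so pointwise convergence is preserved.\<close>

lemma smooth_lipschitz_AE_approximation:
  fixes v :: "'a::euclidean_space \<Rightarrow> 'b::euclidean_space"
  assumes U: "convex U" "closed U" "U \<noteq> {}" and v: "v \<in> borel_measurable lebesgue" "range v \<subseteq> U"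
  obtains w where "\<And>n. range (w n) \<subseteq> U" and "\<And>n. \<exists>L. L-lipschitz_on UNIV (w n)"
    and "\<And>n. smooth_on UNIV (w n)" and "AE z in lebesgue. (\<lambda>n. w n z) \<longlonglongrightarrow> v z"
proof -
  have "v measurable_on UNIV"
    using v by (intro lebesgue_measurable_imp_measurable_on) auto
  then obtain N g where N: "negligible N" and g: "\<And>n. continuous_on UNIV (g n)"
    and lim_g: "\<And>x. x \<notin> N \<Longrightarrow> (\<lambda>n. g n x) \<longlonglongrightarrow> v x"
    unfolding measurable_on_def by auto
  define h where "h n z = closest_point U (g n z)" for n :: nat and z
  have h: "continuous_on UNIV (h n)" "range (h n) \<subseteq> U" for n
    unfolding h_def[abs_def] using U g
    by (auto intro!: closest_point_in_set continuous_on_compose2[OF continuous_on_closest_point[of U UNIV]])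
  have lim_h: "(\<lambda>n. h n z) \<longlonglongrightarrow> v z" if "z \<notin> N" for z
  proof -
    have "(\<lambda>n. h n z) \<longlonglongrightarrow> closest_point U (v z)"
      unfolding h_def
      by (intro isCont_tendsto_compose[OF continuous_at_closest_point] U lim_g that)
    then show ?thesis
      using v by (simp add: closest_point_self range_subsetD)
  qed
  have "\<exists>w. range w \<subseteq> U \<and> (\<exists>L. L-lipschitz_on UNIV w) \<and> smooth_on UNIV w \<and>
      (\<forall>z\<in>cball 0 (real n). dist (w z) (h n z) < inverse (real (Suc n)))" for n
  proof -
    have "continuous_on (cball 0 (real n)) (h n)" "h n ` cball 0 (real n) \<subseteq> U"
      using h[of n] by (auto intro: continuous_on_subset)
    moreover have "cball (0 :: 'a) (real n) \<noteq> {}" "0 < inverse (real (Suc n))"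
      by auto
    ultimately obtain w where "range w \<subseteq> U" "\<exists>L. L-lipschitz_on UNIV w" "smooth_on UNIV w"
      "\<And>z. z \<in> cball 0 (real n) \<Longrightarrow> dist (w z) (h n z) < inverse (real (Suc n))"
      using smooth_lipschitz_uniform_approximation[OF U(1) compact_cball] by blast
    then show ?thesis by blast
  qed
  then obtain w where w: "\<And>n. range (w n) \<subseteq> U" "\<And>n. \<exists>L. L-lipschitz_on UNIV (w n)"
      "\<And>n. smooth_on UNIV (w n)"
    and close: "\<And>n z. z \<in> cball 0 (real n) \<Longrightarrow> dist (w n z) (h n z) < inverse (real (Suc n))"
    by metis
  have "(\<lambda>n. w n z) \<longlonglongrightarrow> v z" if "z \<notin> N" for z
  proof (rule Lim_transform[OF lim_h[OF that]])
    obtain n0 where n0: "norm z \<le> real n0" using real_arch_simple by blast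
    have "\<forall>\<^sub>F n in sequentially. norm (w n z - h n z) \<le> inverse (real (Suc n))"
      using eventually_ge_at_top[of n0]
    proof eventually_elim
      case (elim n)
      then have "dist (w n z) (h n z) < inverse (real (Suc n))"
        using n0 by (intro close) auto
      then show ?case by (simp add: dist_norm)
    qed
    then show "(\<lambda>n. w n z - h n z) \<longlonglongrightarrow> 0"
      by (rule Lim_null_comparison[OF _ LIMSEQ_inverse_real_of_nat])
  qed
  moreover have "AE z in lebesgue. z \<notin> N"
    using N by (auto simp: negligible_iff_null_sets intro: AE_not_in)
  ultimately have "AE z in lebesgue. (\<lambda>n. w n z) \<longlonglongrightarrow> v z"
    by (auto elim: eventually_mono)
  with w that show thesis by blast
qed

section \<open>Iterated integrals against Lebesgue measure\<close>

text \<open>Being almost everywhere equal to a measurable function, \<open>h\<close> is measurable for the completed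
  measure. This covers inner integrals, which are controlled only for almost every parameter.\<close>

lemma integral_completion_cong_AE:
  fixes h h' :: "'a \<Rightarrow> real"
  assumes ae: "AE x in M. h x = h' x" and h': "h' \<in> borel_measurable M"
  shows "integral\<^sup>L (completion M) h = integral\<^sup>L M h'"
proof -
  have ae': "AE x in completion M. h x = h' x"
    using ae by (rule AE_completion)
  have meas': "h' \<in> borel_measurable (completion M)"
    using h' by (rule measurable_completion)
  have "h \<in> borel_measurable (completion M)"
  proof (rule measurableI)
    fix A :: "real set" assume A: "A \<in> sets borel"
    show "h -` A \<inter> space (completion M) \<in> sets (completion M)"
    proof (rule completion.in_sets_AE)
      show "h' -` A \<inter> space (completion M) \<in> sets (completion M)"
        using meas' A by (rule measurable_sets)
      show "AE x in completion M. x \<in> h' -` A \<inter> space (completion M)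
          \<longleftrightarrow> x \<in> h -` A \<inter> space (completion M)"
        using ae' by eventually_elim simp
    qed simp
  qed simp
  then have "integral\<^sup>L (completion M) h = integral\<^sup>L (completion M) h'"
    using meas' ae' by (intro integral_cong_AE)
  then show ?thesis
    using h' by (simp add: integral_completion)
qed

text \<open>Lebesgue measure on a product is not the product of the Lebesgue measures on the factors but
  its completion, so sections of \<open>F\<close> may fail to be measurable. Replacing \<open>F\<close> by an almost everywhere
  equal Borel function changes, for almost every \<open>t\<close>, its section only on a null set, and
  reduces the claim to Fubini's theorem for Borel measure.\<close>

lemma lebesgue_integral_iterated:
  fixes F :: "'a::euclidean_space \<times> 'b::euclidean_space \<Rightarrow> real"
  assumes F: "integrable lebesgue F"
  shows "(LINT t|lebesgue. (LINT x|lebesgue. F (t, x))) = integral\<^sup>L lebesgue F"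
proof -
  have "F \<in> borel_measurable lebesgue" using F by simp
  then obtain F' where F'[measurable]: "F' \<in> borel_measurable lborel" and ae: "AE z in lborel. F z = F' z"
    using completion_ex_borel_measurable_real by blast
  have "integrable lebesgue F'"
    using F ae F' by (intro integrable_cong_AE_imp[OF F] measurable_completion)
      (auto intro!: AE_completion elim: eventually_mono)
  then have int: "integrable (lborel \<Otimes>\<^sub>M lborel) F'"
    using F' by (simp add: integrable_completion lborel_prod)
  then have meas: "F' \<in> borel_measurable (lborel \<Otimes>\<^sub>M lborel)" by simp
  have "AE t in lborel. AE x in lborel. F (t, x) = F' (t, x)"
    using ae by (intro lborel_pair.AE_pair) (simp only: lborel_prod)
  then have "AE t in lborel. (LINT x|lebesgue. F (t, x)) = (LINT x|lborel. F' (t, x))"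
  proof eventually_elim
    case (elim t)
    then show ?case
      using meas by (intro integral_completion_cong_AE measurable_Pair2[OF meas]) auto
  qed
  then have "(LINT t|lebesgue. (LINT x|lebesgue. F (t, x))) = (LINT t|lborel. (LINT x|lborel. F' (t, x)))"
    using meas by (intro integral_completion_cong_AE lborel.borel_measurable_lebesgue_integral) simp_all
  also have "\<dots> = integral\<^sup>L lborel F'"
    using lborel_pair.integral_fst'[OF int] by (simp add: lborel_prod)
  also have "\<dots> = integral\<^sup>L lebesgue F"
    using integral_completion_cong_AE[OF ae F'] by simp
  finally show ?thesis .
qed

lemma closed_time_space: "closed (time_space :: (real \<times> (real^'d)) set)"
  by (simp add: time_space_def closed_Times)

text \<open>The integrand is dominated by \<open>M * \<bar>f\<bar>\<close>, so only measurability takes work: \<open>g\<close> is continuous,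
  hence Borel, just on the closed set \<open>{0..} \<times> UNIV \<times> U\<close>, into which a policy maps time-space.\<close>

lemma pairing_integrand_integrable:
  fixes w :: "real \<times> (real^'d) \<Rightarrow> real^'m" and f :: "real \<times> (real^'d) \<Rightarrow> real"
    and g :: "real \<times> (real^'d) \<times> (real^'m) \<Rightarrow> real"
  assumes w: "det_Markov_policy U w" and f: "set_integrable lebesgue time_space f"
    and g: "continuous_on ({0..} \<times> UNIV \<times> U) g"
    and M: "\<And>y. y \<in> {0..} \<times> UNIV \<times> U \<Longrightarrow> \<bar>g y\<bar> \<le> M"
  shows "set_integrable lebesgue time_space (\<lambda>(t, x). f (t, x) * g (t, x, w (t, x)))"
proof -
  let ?S = "time_space :: (real \<times> (real^'d)) set"
  let ?p = "\<lambda>z. (fst z, snd z, w z)"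
  have S: "?S \<in> sets borel"
    using closed_time_space by (rule borel_closed)
  have "?p \<in> restrict_space borel ?S \<rightarrow>\<^sub>M restrict_space borel ({0..} \<times> UNIV \<times> U)"
  proof (rule measurable_restrict_space2)
    show "?p \<in> space (restrict_space borel ?S) \<rightarrow> {0..} \<times> UNIV \<times> U"
      using w by (auto simp: det_Markov_policy_def time_space_def space_restrict_space)
    have [measurable]: "w \<in> borel_measurable (restrict_space borel ?S)"
      using w by (simp add: det_Markov_policy_def)
    have [measurable]: "fst \<in> borel_measurable (restrict_space borel ?S)"
      "snd \<in> borel_measurable (restrict_space borel ?S)"
      by (intro measurable_restrict_space1 borel_measurable_continuous_onI continuous_intros)+
    show "?p \<in> borel_measurable (restrict_space borel ?S)"
      by measurable
  qed
  then have "(\<lambda>z. g (?p z)) \<in> borel_measurable (restrict_space borel ?S)"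
    by (rule measurable_compose[OF _ borel_measurable_continuous_on_restrict[OF g]])
  then have "(\<lambda>z. indicator ?S z *\<^sub>R g (?p z)) \<in> borel_measurable borel"
    using S by (simp add: borel_measurable_restrict_space_iff)
  then have gm: "(\<lambda>z. indicator ?S z *\<^sub>R g (?p z)) \<in> borel_measurable lebesgue"
    by (intro measurable_completion) simp
  have "integrable lebesgue (\<lambda>z. (indicator ?S z *\<^sub>R g (?p z)) * (indicator ?S z *\<^sub>R f z))"
  proof (rule Bochner_Integration.integrable_bound)
    show "integrable lebesgue (\<lambda>z. M * (indicator ?S z *\<^sub>R f z))"
      using f unfolding set_integrable_def by (rule integrable_mult_right)
    show "(\<lambda>z. (indicator ?S z *\<^sub>R g (?p z)) * (indicator ?S z *\<^sub>R f z)) \<in> borel_measurable lebesgue"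
      using f gm unfolding set_integrable_def
      by (intro borel_measurable_times) auto
    show "AE z in lebesgue. norm ((indicator ?S z *\<^sub>R g (?p z)) * (indicator ?S z *\<^sub>R f z))
        \<le> norm (M * (indicator ?S z *\<^sub>R f z))"
    proof (rule AE_I2)
      fix z
      show "norm ((indicator ?S z *\<^sub>R g (?p z)) * (indicator ?S z *\<^sub>R f z))
          \<le> norm (M * (indicator ?S z *\<^sub>R f z))"
      proof (cases "z \<in> ?S")
        case True
        then have "?p z \<in> {0..} \<times> UNIV \<times> U"
          using w by (auto simp: det_Markov_policy_def time_space_def)
        from M[OF this] True show ?thesis
          by (auto simp: abs_mult intro!: mult_right_mono)
      qed simp
    qed
  qed
  then show ?thesis
    unfolding set_integrable_def
    by (rule back_subst[where P = "integrable lebesgue"]) (auto simp: fun_eq_iff indicator_def)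
qed

lemma policy_pairing_eq_LINT:
  assumes "set_integrable lebesgue time_space (\<lambda>(t, x). f (t, x) * g (t, x, w (t, x)))"
  shows "policy_pairing f g w = (LINT (t, x):time_space|lebesgue. f (t, x) * g (t, x, w (t, x)))"
proof -
  have "indicator {0..} t *\<^sub>R (LINT x|lebesgue. f (t, x) * g (t, x, w (t, x)))
      = (LINT x|lebesgue. indicator time_space (t, x) *\<^sub>R (f (t, x) * g (t, x, w (t, x))))" for t
    by (cases "t \<ge> 0") (auto simp: time_space_def)
  then show ?thesis
    using lebesgue_integral_iterated[OF assms[unfolded set_integrable_def]]
    by (simp add: policy_pairing_def set_lebesgue_integral_def)
qed

lemma policy_pairing_tendsto:
  fixes v :: "real \<times> (real^'d) \<Rightarrow> real^'m"
  assumes v: "det_Markov_policy U v" and w: "\<And>n. det_Markov_policy U (w n)"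
    and lim: "AE z in lebesgue. z \<in> time_space \<longrightarrow> (\<lambda>n. w n z) \<longlonglongrightarrow> v z"
    and f: "set_integrable lebesgue time_space f"
    and g: "continuous_on ({0..} \<times> UNIV \<times> U) g" "bounded (g ` ({0..} \<times> UNIV \<times> U))"
  shows "(\<lambda>n. policy_pairing f g (w n)) \<longlonglongrightarrow> policy_pairing f g v"
proof -
  let ?S = "time_space :: (real \<times> (real^'d)) set"
  let ?F = "\<lambda>w z. indicator ?S z *\<^sub>R (case z of (t, x) \<Rightarrow> f (t, x) * g (t, x, w (t, x)))"
  obtain M where M: "\<And>y. y \<in> {0..} \<times> UNIV \<times> U \<Longrightarrow> \<bar>g y\<bar> \<le> M"
    using g(2) unfolding bounded_iff by auto
  have int: "set_integrable lebesgue ?S (\<lambda>(t, x). f (t, x) * g (t, x, u (t, x)))"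
    if "det_Markov_policy U u" for u
    using pairing_integrand_integrable[OF that f g(1) M] .
  have "(\<lambda>n. integral\<^sup>L lebesgue (?F (w n))) \<longlonglongrightarrow> integral\<^sup>L lebesgue (?F v)"
  proof (rule integral_dominated_convergence)
    show "?F v \<in> borel_measurable lebesgue" "\<And>n. ?F (w n) \<in> borel_measurable lebesgue"
      using int[OF v] int[OF w] unfolding set_integrable_def by auto
    show "integrable lebesgue (\<lambda>z. M * \<bar>indicator ?S z *\<^sub>R f z\<bar>)"
      using f unfolding set_integrable_def by (intro integrable_mult_right integrable_abs)
    show "AE z in lebesgue. (\<lambda>n. ?F (w n) z) \<longlonglongrightarrow> ?F v z"
      using lim
    proof eventually_elim
      case (elim z)
      show ?case
      proof (cases "z \<in> ?S")
        case True
        obtain t x where z: "z = (t, x)" by fastforce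
        have "(\<lambda>n. g (t, x, w n (t, x))) \<longlonglongrightarrow> g (t, x, v (t, x))"
          using True elim v w unfolding z
          by (intro continuous_on_tendsto_compose[OF g(1)] tendsto_intros always_eventually)
            (auto simp: det_Markov_policy_def time_space_def Pi_iff)
        then show ?thesis
          unfolding z by (auto intro!: tendsto_intros)
      qed simp
    qed
    show "AE z in lebesgue. norm (?F (w n) z) \<le> M * \<bar>indicator ?S z *\<^sub>R f z\<bar>" for n
    proof (rule AE_I2)
      fix z
      show "norm (?F (w n) z) \<le> M * \<bar>indicator ?S z *\<^sub>R f z\<bar>"
      proof (cases "z \<in> ?S")
        case True
        obtain t x where z: "z = (t, x)" by fastforce
        have "(t, x, w n (t, x)) \<in> {0..} \<times> UNIV \<times> U"
          using w[of n] True by (auto simp: z det_Markov_policy_def time_space_def)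
        from M[OF this] True show ?thesis
          by (auto simp: z abs_mult mult.commute[of "\<bar>f _\<bar>"] intro!: mult_right_mono)
      qed simp
    qed
  qed
  then show ?thesis
    using int[OF v] int[OF w] by (simp add: policy_pairing_eq_LINT set_lebesgue_integral_def)
qed

theorem theorem3p2:
  fixes U :: "(real^'m) set"
    and v :: "real \<times> (real^'d) \<Rightarrow> real^'m"
  assumes "convex U" and "compact U" and "det_Markov_policy U v"
  shows "\<exists>w :: nat \<Rightarrow> real \<Rightarrow> (real \<times> (real^'d) \<Rightarrow> real^'m).
    (\<forall>n. \<forall>\<eta>>0. det_Markov_policy U (w n \<eta>) \<and>
        (\<exists>L. L-lipschitz_on time_space (w n \<eta>)) \<and> smooth_on time_space (w n \<eta>)) \<and>
    (\<forall>(f :: real \<times> (real^'d) \<Rightarrow> real) (g :: real \<times> (real^'d) \<times> (real^'m) \<Rightarrow> real).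
        set_integrable lebesgue time_space f \<and>
        set_integrable lebesgue time_space (\<lambda>z. (f z)\<^sup>2) \<and>
        continuous_on ({0..} \<times> UNIV \<times> U) g \<and> bounded (g ` ({0..} \<times> UNIV \<times> U)) \<longrightarrow>
        (\<exists>l :: nat \<Rightarrow> real.
           (\<forall>n. ((\<lambda>\<eta>. policy_pairing f g (w n \<eta>)) \<longlongrightarrow> l n) (at_right 0)) \<and>
           l \<longlonglongrightarrow> policy_pairing f g v))"
proof -
  let ?S = "time_space :: (real \<times> (real^'d)) set"
  have "(0, 0) \<in> ?S" by (simp add: time_space_def)
  then obtain u0 where u0: "u0 \<in> U"
    using assms(3) unfolding det_Markov_policy_def by blast
  \<comment> \<open>Extending by a value in \<open>U\<close> yields a measurable \<open>U\<close>-valued map on the whole space.\<close>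
  define v0 where "v0 z = (if z \<in> ?S then v z else u0)" for z
  have S: "?S \<in> sets borel"
    using closed_time_space by (rule borel_closed)
  have "v0 \<in> borel_measurable borel"
    unfolding v0_def[abs_def] using assms(3) S
    by (intro measurable_If_restrict_space_iff[THEN iffD2])
      (auto simp: det_Markov_policy_def pred_def)
  then have v0: "v0 \<in> borel_measurable lebesgue"
    by (intro measurable_completion) simp
  have "range v0 \<subseteq> U"
    using assms(3) u0 by (auto simp: v0_def det_Markov_policy_def)
  then obtain w where w: "\<And>n. range (w n) \<subseteq> U" "\<And>n. \<exists>L. L-lipschitz_on UNIV (w n)"
      "\<And>n. smooth_on UNIV (w n)" and lim: "AE z in lebesgue. (\<lambda>n. w n z) \<longlonglongrightarrow> v0 z"
    using assms(1,2) u0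
    by (rule_tac smooth_lipschitz_AE_approximation[OF _ _ _ v0]) (auto dest: compact_imp_closed)
  have policy: "det_Markov_policy U (w n)" for n
  proof -
    have "continuous_on UNIV (w n)"
      using w(2) lipschitz_on_continuous_on by blast
    then have "w n \<in> borel_measurable (restrict_space borel ?S)"
      by (intro measurable_restrict_space1 borel_measurable_continuous_onI)
    then show ?thesis
      using w(1)[of n] by (auto simp: det_Markov_policy_def)
  qed
  have lip: "\<exists>L. L-lipschitz_on ?S (w n)" for n
    using w(2)[of n] lipschitz_on_subset by blast
  have smooth: "smooth_on ?S (w n)" for n
    using w(3)[of n] Ck_on_subset by (fastforce simp: smooth_on_def)
  have lim_v: "AE z in lebesgue. z \<in> ?S \<longrightarrow> (\<lambda>n. w n z) \<longlonglongrightarrow> v z"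
    using lim by eventually_elim (auto simp: v0_def)
  show ?thesis
    using policy lip smooth policy_pairing_tendsto[OF assms(3) policy lim_v]
    by (intro exI[of _ "\<lambda>n \<eta>. w n"]) (auto intro!: exI tendsto_const)
qed

end
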